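(* A quasigroup $(Q,\cdot)$ is A-central if and only if it is an abelian group isotope.
   Context: A quasigroup $(Q,\cdot)$ is a non-empty set $Q$ with a binary operation such that for all $a,b\in Q$ the equations $x\cdot a=b$ and $a\cdot y=b$ each have a unique solution. $\varepsilon$ is the identity permutation of $Q$. An autotopy of $(Q,\cdot)$ is a triple $(\alpha,\beta,\gamma)$ of permutations of $Q$ with $\alpha x\cdot\beta y=\gamma(x\cdot y)$ for all $x,y\in Q$; autotopies form a group $Avt(Q,\cdot)$ under component-wise composition. The A-nuclei are the groups of autotopies: $N^A_l$, those of the form $(\alpha,\varepsilon,\gamma)$; $N^A_r$, those of the form $(\varepsilon,\beta,\gamma)$; $N^A_m$, those of the form $(\alpha,\beta,\varepsilon)$. They are normal subgroups of $Avt(Q,\cdot)$ intersecting pairwise trivially; $N^A_r\times N^A_m$, etc., denote the internal direct products (product subgroups) in $Avt(Q,\cdot)$. The A-centers are: left $Z^A_l=(N^A_r\times N^A_m)\cap N^A_l$, right $Z^A_r=(N^A_l\times N^A_m)\cap N^A_r$, middle $Z^A_m=(N^A_l\times N^A_r)\cap N^A_m$. Their components are the permutation groups ${}_1Z^A_l,{}_3Z^A_l$ (first, third components of elements of $Z^A_l$), ${}_2Z^A_r,{}_3Z^A_r$ (second, third components of elements of $Z^A_r$), ${}_1Z^A_m,{}_2Z^A_m$ (first, second components of elements of $Z^A_m$). $(Q,\cdot)$ is A-central if at least one of ${}_1Z^A_l,{}_3Z^A_l,{}_2Z^A_r,{}_3Z^A_r,{}_1Z^A_m,{}_2Z^A_m$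 acts transitively on $Q$. $(Q,\cdot)$ is an abelian group isotope if there are an abelian group $(Q,+)$ and permutations $\mu_1,\mu_2,\mu_3$ of $Q$ such that $x\cdot y=\mu_3^{-1}(\mu_1x+\mu_2y)$ for all $x,y\in Q$. *)

theory Defs
  imports "HOL-Algebra.Group_Action"
begin

locale quasigroup =
  fixes Q :: "'a set" and f :: "'a \<Rightarrow> 'a \<Rightarrow> 'a" (infixl \<open>\<cdot>\<close> 70)
  assumes nonempty: "Q \<noteq> {}"
    and closed: "\<lbrakk>x \<in> Q; y \<in> Q\<rbrakk> \<Longrightarrow> x \<cdot> y \<in> Q"
    and left_solution: "\<lbrakk>a \<in> Q; b \<in> Q\<rbrakk> \<Longrightarrow> \<exists>!x. x \<in> Q \<and> x \<cdot> a = b"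
    and right_solution: "\<lbrakk>a \<in> Q; b \<in> Q\<rbrakk> \<Longrightarrow> \<exists>!y. y \<in> Q \<and> a \<cdot> y = b"

text \<open>Permutations of \<open>Q\<close> are elements of \<^const>\<open>Bij\<close> \<open>Q\<close>, i.e. extensional functions (undefined
  outside \<open>Q\<close>), so that equality of permutations is equality on \<open>Q\<close> and the identity permutation
  is \<open>\<one>\<^bsub>BijGroup Q\<^esub>\<close>, not \<^const>\<open>id\<close>.\<close>

definition autotopies :: "'a set \<Rightarrow> ('a \<Rightarrow> 'a \<Rightarrow> 'a) \<Rightarrow> (('a \<Rightarrow> 'a) \<times> ('a \<Rightarrow> 'a) \<times> ('a \<Rightarrow> 'a)) set" where
  "autotopies Q f = {(\<alpha>, \<beta>, \<gamma>). \<alpha> \<in> Bij Q \<and> \<beta> \<in> Bij Q \<and> \<gamma> \<in> Bij Q \<and>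
     (\<forall>x\<in>Q. \<forall>y\<in>Q. f (\<alpha> x) (\<beta> y) = \<gamma> (f x y))}"

definition Avt :: "'a set \<Rightarrow> ('a \<Rightarrow> 'a \<Rightarrow> 'a) \<Rightarrow> (('a \<Rightarrow> 'a) \<times> ('a \<Rightarrow> 'a) \<times> ('a \<Rightarrow> 'a)) monoid" where
  "Avt Q f = (BijGroup Q \<times>\<times> BijGroup Q \<times>\<times> BijGroup Q)\<lparr>carrier := autotopies Q f\<rparr>"

definition left_A_nucleus where
  "left_A_nucleus Q f = {(\<alpha>, \<beta>, \<gamma>) \<in> carrier (Avt Q f). \<beta> = \<one>\<^bsub>BijGroup Q\<^esub>}"

definition right_A_nucleus where
  "right_A_nucleus Q f = {(\<alpha>, \<beta>, \<gamma>) \<in> carrier (Avt Q f). \<alpha> = \<one>\<^bsub>BijGroup Q\<^esub>}"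

definition middle_A_nucleus where
  "middle_A_nucleus Q f = {(\<alpha>, \<beta>, \<gamma>) \<in> carrier (Avt Q f). \<gamma> = \<one>\<^bsub>BijGroup Q\<^esub>}"

text \<open>The internal direct products of A-nuclei are rendered as products of subsets of \<^const>\<open>Avt\<close>.\<close>

definition left_A_center where
  "left_A_center Q f =
     (right_A_nucleus Q f <#>\<^bsub>Avt Q f\<^esub> middle_A_nucleus Q f) \<inter> left_A_nucleus Q f"

definition right_A_center where
  "right_A_center Q f =
     (left_A_nucleus Q f <#>\<^bsub>Avt Q f\<^esub> middle_A_nucleus Q f) \<inter> right_A_nucleus Q f"

definition middle_A_center where
  "middle_A_center Q f =
     (left_A_nucleus Q f <#>\<^bsub>Avt Q f\<^esub> right_A_nucleus Q f) \<inter> middle_A_nucleus Q f"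

definition component1 :: "('p \<times> 'p \<times> 'p) set \<Rightarrow> 'p set" where
  "component1 Z = (\<lambda>(\<alpha>, \<beta>, \<gamma>). \<alpha>) ` Z"

definition component2 :: "('p \<times> 'p \<times> 'p) set \<Rightarrow> 'p set" where
  "component2 Z = (\<lambda>(\<alpha>, \<beta>, \<gamma>). \<beta>) ` Z"

definition component3 :: "('p \<times> 'p \<times> 'p) set \<Rightarrow> 'p set" where
  "component3 Z = (\<lambda>(\<alpha>, \<beta>, \<gamma>). \<gamma>) ` Z"

text \<open>The action of a permutation group \<open>H\<close> on \<open>Q\<close> is the tautological one, with \<^const>\<open>id\<close> as
  the homomorphism from \<open>H\<close> to \<^const>\<open>BijGroup\<close> \<open>Q\<close>.\<close>

definition acts_transitively :: "('a \<Rightarrow> 'a) set \<Rightarrow> 'a set \<Rightarrow> bool" where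
  "acts_transitively H Q \<longleftrightarrow> transitive_action ((BijGroup Q)\<lparr>carrier := H\<rparr>) Q id"

definition A_central :: "'a set \<Rightarrow> ('a \<Rightarrow> 'a \<Rightarrow> 'a) \<Rightarrow> bool" where
  "A_central Q f \<longleftrightarrow>
     acts_transitively (component1 (left_A_center Q f)) Q \<or>
     acts_transitively (component3 (left_A_center Q f)) Q \<or>
     acts_transitively (component2 (right_A_center Q f)) Q \<or>
     acts_transitively (component3 (right_A_center Q f)) Q \<or>
     acts_transitively (component1 (middle_A_center Q f)) Q \<or>
     acts_transitively (component2 (middle_A_center Q f)) Q"

definition abelian_group_isotope :: "'a set \<Rightarrow> ('a \<Rightarrow> 'a \<Rightarrow> 'a) \<Rightarrow> bool" where
  "abelian_group_isotope Q f \<longleftrightarrow>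
     (\<exists>G :: 'a monoid. \<exists>\<mu>\<^sub>1 \<in> Bij Q. \<exists>\<mu>\<^sub>2 \<in> Bij Q. \<exists>\<mu>\<^sub>3 \<in> Bij Q.
        comm_group G \<and> carrier G = Q \<and>
        (\<forall>x\<in>Q. \<forall>y\<in>Q. f x y = inv_into Q \<mu>\<^sub>3 (\<mu>\<^sub>1 x \<otimes>\<^bsub>G\<^esub> \<mu>\<^sub>2 y)))"

end

theory Submission
  imports Defs
begin

text \<open>The argument rests on triples \<open>(\<alpha>, \<beta>, \<gamma>)\<close> of self-maps of \<open>Q\<close> with
  \<open>\<alpha> x \<cdot> y = \<gamma> (x \<cdot> y) = x \<cdot> \<beta> y\<close>.  Splitting an element of an A-center into its two nuclear
  factors shows that each of the six component groups consists of components of such triples, and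
  the equations carry transitivity of the first or second components over to the third ones.

  If \<open>(\<alpha>, \<beta>, \<gamma>)\<close> and \<open>(\<alpha>', \<beta>', \<gamma>')\<close> are such triples, then \<open>\<gamma>\<close> and \<open>\<gamma>'\<close> commute, as one of them
  can act on the left factor of a product and the other one on the right factor.  So in an
  A-central quasigroup the third components form a transitive family of commuting maps.  Such a
  family consists of the translations of an abelian group on \<open>Q\<close> whose neutral element \<open>e\<close> may be
  prescribed (lemma \<open>comm_group_of_commuting_transitive\<close>).  Choosing \<open>e = u \<cdot> u\<close> makes
  \<open>x \<cdot> y\<close> the sum of \<open>x \<cdot> u\<close> and \<open>u \<cdot> y\<close>: if \<open>\<gamma> e = x \<cdot> u\<close>, then \<open>\<alpha> u \<cdot> u = x \<cdot> u\<close>, so \<open>\<alpha> u = x\<close> and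
  \<open>\<gamma> (u \<cdot> y) = \<alpha> u \<cdot> y = x \<cdot> y\<close>.

  Conversely, let \<open>x \<cdot> y = \<mu>\<^sub>3\<^sup>-\<^sup>1 (\<mu>\<^sub>1 x + \<mu>\<^sub>2 y)\<close>, and let \<open>\<alpha>\<^sub>a\<close>, \<open>\<beta>\<^sub>a\<close>, \<open>\<gamma>\<^sub>a\<close> be the translation by \<open>a\<close>
  conjugated by \<open>\<mu>\<^sub>1\<close>, \<open>\<mu>\<^sub>2\<close>, \<open>\<mu>\<^sub>3\<close>.  All triples \<open>(\<alpha>\<^sub>a, \<beta>\<^sub>b, \<gamma>\<^sub>a\<^sub>+\<^sub>b)\<close> are autotopies, and
  \<open>(\<alpha>\<^sub>a, \<epsilon>, \<gamma>\<^sub>a) = (\<epsilon>, \<beta>\<^sub>a, \<gamma>\<^sub>a) (\<alpha>\<^sub>a, \<beta>\<^sub>-\<^sub>a, \<epsilon>)\<close> lies in the left A-center.  Every element of the left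
  A-nucleus has some \<open>\<alpha>\<^sub>a\<close> as its first component, so the first components of the left A-center
  are exactly the \<open>\<alpha>\<^sub>a\<close>, and these form a transitive group.\<close>

section \<open>Transitive families of commuting maps\<close>

text \<open>For \<open>a \<in> Q\<close>, the sum \<open>a + b\<close> is \<open>g b\<close> for any member \<open>g\<close> with \<open>g e = a\<close>.  The choice of \<open>g\<close>
  does not matter, since a member is determined by its value at \<open>e\<close>.\<close>

lemma comm_group_of_commuting_transitive:
  fixes Q :: "'a set" and C :: "('a \<Rightarrow> 'a) set"
  assumes e: "e \<in> Q"
    and maps: "\<And>g x. g \<in> C \<Longrightarrow> x \<in> Q \<Longrightarrow> g x \<in> Q"
    and comm: "\<And>g h x. g \<in> C \<Longrightarrow> h \<in> C \<Longrightarrow> x \<in> Q \<Longrightarrow> g (h x) = h (g x)"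
    and trans: "\<And>x y. x \<in> Q \<Longrightarrow> y \<in> Q \<Longrightarrow> \<exists>g\<in>C. g x = y"
  obtains G :: "'a monoid" where "comm_group G" "carrier G = Q"
    "\<And>g b. g \<in> C \<Longrightarrow> b \<in> Q \<Longrightarrow> g e \<otimes>\<^bsub>G\<^esub> b = g b"
proof -
  have regular: "g x = h x" if "g \<in> C" "h \<in> C" "g e = h e" "x \<in> Q" for g h x
  proof -
    obtain k where "k \<in> C" "k e = x" using trans e \<open>x \<in> Q\<close> by blast
    then show ?thesis using comm e that by metis
  qed
  define s where "s a = (SOME g. g \<in> C \<and> g e = a)" for a
  have s: "s a \<in> C" "s a e = a" if "a \<in> Q" for a
    using someI_ex[of "\<lambda>g. g \<in> C \<and> g e = a"] trans[OF e that] unfolding s_def by blast+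
  define G :: "'a monoid" where "G = \<lparr>carrier = Q, mult = (\<lambda>a b. s a b), one = e\<rparr>"
  have carrier: "carrier G = Q" by (simp add: G_def)
  have mult: "g e \<otimes>\<^bsub>G\<^esub> b = g b" if "g \<in> C" "b \<in> Q" for g b
    using regular[of "s (g e)" g b] s[of "g e"] maps e that by (simp add: G_def)
  have mult_values: "g e \<otimes>\<^bsub>G\<^esub> h e = g (h e)" if "g \<in> C" "h \<in> C" for g h
    using mult maps e that by blast
  have "comm_group G"
  proof (rule comm_groupI)
    fix x y assume "x \<in> carrier G" "y \<in> carrier G"
    then show "x \<otimes>\<^bsub>G\<^esub> y \<in> carrier G" using s maps by (simp add: G_def)
  next
    show "\<one>\<^bsub>G\<^esub> \<in> carrier G" using e by (simp add: G_def)
  next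
    fix x y z assume "x \<in> carrier G" "y \<in> carrier G" "z \<in> carrier G"
    then have xyz: "x \<in> Q" "y \<in> Q" "z \<in> Q" by (simp_all add: carrier)
    note g = s[OF xyz(1)] and h = s[OF xyz(2)] and k = s[OF xyz(3)]
    have "s x y \<in> Q" using g maps xyz by blast
    note p = s[OF this]
    \<comment> \<open>Both iterated sums arise from \<open>e\<close> by applying the three commuting members for \<open>x\<close>, \<open>y\<close>, \<open>z\<close>.\<close>
    have "s (s x y) z = s z (s x y)" using comm[OF p(1) k(1) e] p k by metis
    also have "\<dots> = s x (s z y)" using comm[OF k(1) g(1)] xyz by metis
    also have "s z y = s y z" using comm[OF k(1) h(1) e] k h by metis
    finally have "s (s x y) z = s x (s y z)" .
    then show "x \<otimes>\<^bsub>G\<^esub> y \<otimes>\<^bsub>G\<^esub> z = x \<otimes>\<^bsub>G\<^esub> (y \<otimes>\<^bsub>G\<^esub> z)" by (simp add: G_def)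
  next
    fix x y assume "x \<in> carrier G" "y \<in> carrier G"
    then show "x \<otimes>\<^bsub>G\<^esub> y = y \<otimes>\<^bsub>G\<^esub> x"
      using mult_values[of "s x" "s y"] mult_values[of "s y" "s x"] comm[of "s x" "s y" e] s e
      by (simp add: carrier)
  next
    fix x assume "x \<in> carrier G"
    then have x: "x \<in> Q" by (simp add: carrier)
    obtain h where h: "h \<in> C" "h e = e" using trans e by blast
    have "h x = x" using comm[OF h(1) s(1)[OF x] e] h s[OF x] by metis
    then show "\<one>\<^bsub>G\<^esub> \<otimes>\<^bsub>G\<^esub> x = x" using mult[OF h(1) x] h by (simp add: G_def)
  next
    fix x assume "x \<in> carrier G"
    then have x: "x \<in> Q" by (simp add: carrier)
    obtain h where h: "h \<in> C" "h x = e" using trans e x by blast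
    have "h e \<otimes>\<^bsub>G\<^esub> x = \<one>\<^bsub>G\<^esub>" using mult[OF h(1) x] h by (simp add: G_def)
    then show "\<exists>y\<in>carrier G. y \<otimes>\<^bsub>G\<^esub> x = \<one>\<^bsub>G\<^esub>" using maps h e carrier by blast
  qed
  then show thesis using that carrier mult by blast
qed

section \<open>Central triples\<close>

text \<open>The equations say that \<open>(\<alpha>, \<epsilon>, \<gamma>)\<close> and \<open>(\<epsilon>, \<beta>, \<gamma>)\<close> satisfy the autotopy condition.  The maps
  are not required to be bijective or extensional.\<close>

definition central_triple ::
  "'a set \<Rightarrow> ('a \<Rightarrow> 'a \<Rightarrow> 'a) \<Rightarrow> ('a \<Rightarrow> 'a) \<Rightarrow> ('a \<Rightarrow> 'a) \<Rightarrow> ('a \<Rightarrow> 'a) \<Rightarrow> bool" where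
  "central_triple Q f \<alpha> \<beta> \<gamma> \<longleftrightarrow> \<alpha> \<in> Q \<rightarrow> Q \<and> \<beta> \<in> Q \<rightarrow> Q \<and> \<gamma> \<in> Q \<rightarrow> Q \<and>
     (\<forall>x\<in>Q. \<forall>y\<in>Q. f (\<alpha> x) y = \<gamma> (f x y) \<and> f x (\<beta> y) = \<gamma> (f x y))"

lemma one_BijGroup_apply [simp]: "x \<in> Q \<Longrightarrow> \<one>\<^bsub>BijGroup Q\<^esub> x = x"
  by (simp add: BijGroup_def)

lemma mult_BijGroup_apply:
  "\<lbrakk>g \<in> Bij Q; h \<in> Bij Q; x \<in> Q\<rbrakk> \<Longrightarrow> (g \<otimes>\<^bsub>BijGroup Q\<^esub> h) x = g (h x)"
  by (simp add: BijGroup_def compose_eq)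

lemma carrier_BijGroup: "carrier (BijGroup Q) = Bij Q"
  by (simp add: BijGroup_def)

lemma carrier_Avt: "carrier (Avt Q f) = autotopies Q f"
  by (simp add: Avt_def)

lemma mult_Avt: "(\<alpha>, \<beta>, \<gamma>) \<otimes>\<^bsub>Avt Q f\<^esub> (\<alpha>', \<beta>', \<gamma>') =
   (\<alpha> \<otimes>\<^bsub>BijGroup Q\<^esub> \<alpha>', \<beta> \<otimes>\<^bsub>BijGroup Q\<^esub> \<beta>', \<gamma> \<otimes>\<^bsub>BijGroup Q\<^esub> \<gamma>')"
  by (simp add: Avt_def DirProd_def)

lemma mult_BijGroup_one:
  assumes "g \<in> Bij Q"
  shows "g \<otimes>\<^bsub>BijGroup Q\<^esub> \<one>\<^bsub>BijGroup Q\<^esub> = g" "\<one>\<^bsub>BijGroup Q\<^esub> \<otimes>\<^bsub>BijGroup Q\<^esub> g = g"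
  using assms group.is_monoid[OF group_BijGroup, of Q]
  by (simp_all add: monoid.r_one monoid.l_one carrier_BijGroup)

text \<open>An element \<open>(\<alpha>, \<epsilon>, \<gamma>)\<close> of the left A-center is a product \<open>(\<epsilon>, \<beta>', \<gamma>) (\<alpha>, \<beta>'', \<epsilon>)\<close>, whose first
  factor supplies the second component of the triple.  The right A-center is treated likewise.\<close>

lemma left_A_center_central_triple:
  assumes "(\<alpha>, \<beta>, \<gamma>) \<in> left_A_center Q f"
  shows "\<exists>\<beta>'. central_triple Q f \<alpha> \<beta>' \<gamma>"
proof -
  obtain \<beta>' \<gamma>' \<alpha>' \<beta>'' where
    "(\<one>\<^bsub>BijGroup Q\<^esub>, \<beta>', \<gamma>') \<in> autotopies Q f" "(\<alpha>', \<beta>'', \<one>\<^bsub>BijGroup Q\<^esub>) \<in> autotopies Q f"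
    and "(\<alpha>, \<beta>, \<gamma>) = (\<one>\<^bsub>BijGroup Q\<^esub>, \<beta>', \<gamma>') \<otimes>\<^bsub>Avt Q f\<^esub> (\<alpha>', \<beta>'', \<one>\<^bsub>BijGroup Q\<^esub>)"
    using assms
    by (auto simp: left_A_center_def set_mult_def right_A_nucleus_def middle_A_nucleus_def carrier_Avt)
  moreover have "\<gamma> = \<gamma>'" using calculation by (simp add: mult_Avt autotopies_def mult_BijGroup_one)
  moreover have "(\<alpha>, \<one>\<^bsub>BijGroup Q\<^esub>, \<gamma>) \<in> autotopies Q f"
    using assms by (auto simp: left_A_center_def left_A_nucleus_def carrier_Avt)
  ultimately have "central_triple Q f \<alpha> \<beta>' \<gamma>"
    by (auto simp: central_triple_def autotopies_def dest: Bij_imp_funcset)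
  then show ?thesis by blast
qed

lemma right_A_center_central_triple:
  assumes "(\<alpha>, \<beta>, \<gamma>) \<in> right_A_center Q f"
  shows "\<exists>\<alpha>'. central_triple Q f \<alpha>' \<beta> \<gamma>"
proof -
  obtain \<alpha>' \<gamma>' \<alpha>'' \<beta>' where
    "(\<alpha>', \<one>\<^bsub>BijGroup Q\<^esub>, \<gamma>') \<in> autotopies Q f" "(\<alpha>'', \<beta>', \<one>\<^bsub>BijGroup Q\<^esub>) \<in> autotopies Q f"
    and "(\<alpha>, \<beta>, \<gamma>) = (\<alpha>', \<one>\<^bsub>BijGroup Q\<^esub>, \<gamma>') \<otimes>\<^bsub>Avt Q f\<^esub> (\<alpha>'', \<beta>', \<one>\<^bsub>BijGroup Q\<^esub>)"
    using assms
    by (auto simp: right_A_center_def set_mult_def left_A_nucleus_def middle_A_nucleus_def carrier_Avt)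
  moreover have "\<gamma> = \<gamma>'" using calculation by (simp add: mult_Avt autotopies_def mult_BijGroup_one)
  moreover have "(\<one>\<^bsub>BijGroup Q\<^esub>, \<beta>, \<gamma>) \<in> autotopies Q f"
    using assms by (auto simp: right_A_center_def right_A_nucleus_def carrier_Avt)
  ultimately have "central_triple Q f \<alpha>' \<beta> \<gamma>"
    by (auto simp: central_triple_def autotopies_def dest: Bij_imp_funcset)
  then show ?thesis by blast
qed

text \<open>Here \<open>(\<alpha>, \<beta>, \<epsilon>) = (\<alpha>, \<epsilon>, \<gamma>\<^sub>1) (\<epsilon>, \<beta>, \<gamma>\<^sub>1\<^sup>-\<^sup>1)\<close>, so \<open>\<alpha>\<close> and \<open>\<beta>\<close> belong to two triples that are inverse to each other:
  \<open>(\<alpha>, \<beta>\<^sup>-\<^sup>1, \<gamma>\<^sub>1)\<close> and \<open>(\<alpha>\<^sup>-\<^sup>1, \<beta>, \<gamma>\<^sub>1\<^sup>-\<^sup>1)\<close>.\<close>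

lemma (in quasigroup) middle_A_center_central_triple:
  assumes "(\<alpha>, \<beta>, \<gamma>) \<in> middle_A_center Q f"
  shows "\<exists>\<beta>' \<gamma>'. central_triple Q f \<alpha> \<beta>' \<gamma>'" "\<exists>\<alpha>' \<gamma>'. central_triple Q f \<alpha>' \<beta> \<gamma>'"
proof -
  obtain \<alpha>\<^sub>1 \<gamma>\<^sub>1 \<beta>\<^sub>2 \<gamma>\<^sub>2 where 1: "(\<alpha>\<^sub>1, \<one>\<^bsub>BijGroup Q\<^esub>, \<gamma>\<^sub>1) \<in> autotopies Q f"
    and 2: "(\<one>\<^bsub>BijGroup Q\<^esub>, \<beta>\<^sub>2, \<gamma>\<^sub>2) \<in> autotopies Q f"
    and prod: "(\<alpha>, \<beta>, \<gamma>) = (\<alpha>\<^sub>1, \<one>\<^bsub>BijGroup Q\<^esub>, \<gamma>\<^sub>1) \<otimes>\<^bsub>Avt Q f\<^esub> (\<one>\<^bsub>BijGroup Q\<^esub>, \<beta>\<^sub>2, \<gamma>\<^sub>2)"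
    using assms
    by (auto simp: middle_A_center_def set_mult_def left_A_nucleus_def right_A_nucleus_def carrier_Avt)
  have eqs: "\<alpha> = \<alpha>\<^sub>1" "\<beta> = \<beta>\<^sub>2"
    using 1 2 prod by (auto simp: mult_Avt autotopies_def mult_BijGroup_one)
  have Bij: "\<alpha> \<in> Bij Q" "\<beta> \<in> Bij Q" "\<gamma>\<^sub>1 \<in> Bij Q" "\<gamma>\<^sub>2 \<in> Bij Q"
    using 1 2 by (auto simp: autotopies_def eqs)
  have mid: "(\<alpha>, \<beta>, \<one>\<^bsub>BijGroup Q\<^esub>) \<in> autotopies Q f"
    using assms by (auto simp: middle_A_center_def middle_A_nucleus_def carrier_Avt)
  have inv: "inv_into Q \<alpha> x \<in> Q" "\<alpha> (inv_into Q \<alpha> x) = x"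
    "inv_into Q \<beta> x \<in> Q" "\<beta> (inv_into Q \<beta> x) = x" if "x \<in> Q" for x
    using Bij that by (auto simp: Bij_def bij_betw_def f_inv_into_f intro: inv_into_into)
  have prod_eq: "f (\<alpha> x) (\<beta> y) = f x y"
    and left: "f (\<alpha> x) y = \<gamma>\<^sub>1 (f x y)" and right: "f x (\<beta> y) = \<gamma>\<^sub>2 (f x y)"
    if "x \<in> Q" "y \<in> Q" for x y
    using mid 1 2 that closed by (auto simp: autotopies_def eqs)
  have "f x (inv_into Q \<beta> y) = \<gamma>\<^sub>1 (f x y)" if "x \<in> Q" "y \<in> Q" for x y
    using prod_eq[of x "inv_into Q \<beta> y"] left[of x y] inv that by simp
  then have "central_triple Q f \<alpha> (inv_into Q \<beta>) \<gamma>\<^sub>1"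
    using Bij inv left by (auto simp: central_triple_def dest: Bij_imp_funcset)
  then show "\<exists>\<beta>' \<gamma>'. central_triple Q f \<alpha> \<beta>' \<gamma>'" by blast
  have "f (inv_into Q \<alpha> x) y = \<gamma>\<^sub>2 (f x y)" if "x \<in> Q" "y \<in> Q" for x y
    using prod_eq[of "inv_into Q \<alpha> x" y] right[of x y] inv that by simp
  then have "central_triple Q f (inv_into Q \<alpha>) \<beta> \<gamma>\<^sub>2"
    using Bij inv right by (auto simp: central_triple_def dest: Bij_imp_funcset)
  then show "\<exists>\<alpha>' \<gamma>'. central_triple Q f \<alpha>' \<beta> \<gamma>'" by blast
qed

section \<open>A-central quasigroups are abelian group isotopes\<close>

text \<open>The disjuncts in the hypothesis are transitivity on \<open>Q\<close> of the first, second and third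
  components, respectively.\<close>

lemma (in quasigroup) central_triples_transitive3:
  assumes "(\<forall>x\<in>Q. \<forall>y\<in>Q. \<exists>\<alpha> \<beta> \<gamma>. central_triple Q f \<alpha> \<beta> \<gamma> \<and> \<alpha> x = y) \<or>
    (\<forall>x\<in>Q. \<forall>y\<in>Q. \<exists>\<alpha> \<beta> \<gamma>. central_triple Q f \<alpha> \<beta> \<gamma> \<and> \<beta> x = y) \<or>
    (\<forall>x\<in>Q. \<forall>y\<in>Q. \<exists>\<alpha> \<beta> \<gamma>. central_triple Q f \<alpha> \<beta> \<gamma> \<and> \<gamma> x = y)"
    and "x \<in> Q" "y \<in> Q"
  shows "\<exists>\<alpha> \<beta> \<gamma>. central_triple Q f \<alpha> \<beta> \<gamma> \<and> \<gamma> x = y"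
  using assms(1)
proof (elim disjE)
  assume *: "\<forall>x\<in>Q. \<forall>y\<in>Q. \<exists>\<alpha> \<beta> \<gamma>. central_triple Q f \<alpha> \<beta> \<gamma> \<and> \<alpha> x = y"
  obtain u v where uv: "u \<in> Q" "u \<cdot> x = x" "v \<in> Q" "v \<cdot> x = y"
    using left_solution assms(2,3) by metis
  then obtain \<alpha> \<beta> \<gamma> where "central_triple Q f \<alpha> \<beta> \<gamma>" "\<alpha> u = v" using * by blast
  moreover from this have "\<gamma> x = y" using uv assms(2) unfolding central_triple_def by metis
  ultimately show ?thesis by blast
next
  assume *: "\<forall>x\<in>Q. \<forall>y\<in>Q. \<exists>\<alpha> \<beta> \<gamma>. central_triple Q f \<alpha> \<beta> \<gamma> \<and> \<beta> x = y"
  obtain u v where uv: "u \<in> Q" "x \<cdot> u = x" "v \<in> Q" "x \<cdot> v = y"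
    using right_solution assms(2,3) by metis
  then obtain \<alpha> \<beta> \<gamma> where "central_triple Q f \<alpha> \<beta> \<gamma>" "\<beta> u = v" using * by blast
  moreover from this have "\<gamma> x = y" using uv assms(2) unfolding central_triple_def by metis
  ultimately show ?thesis by blast
qed (use assms(2,3) in blast)

lemma (in quasigroup) central_triples_commute:
  assumes "central_triple Q f \<alpha> \<beta> \<gamma>" "central_triple Q f \<alpha>' \<beta>' \<gamma>'" "z \<in> Q"
  shows "\<gamma> (\<gamma>' z) = \<gamma>' (\<gamma> z)"
proof -
  obtain x where x: "x \<in> Q" "x \<cdot> z = z" using left_solution assms(3) by blast
  \<comment> \<open>Both sides equal \<open>\<alpha> x \<cdot> \<beta>' z\<close>.\<close>
  have "\<alpha> x \<in> Q" "\<beta>' z \<in> Q" using assms x by (auto simp: central_triple_def)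
  then show ?thesis using assms x unfolding central_triple_def by metis
qed

lemma (in quasigroup) left_translation_Bij:
  assumes "a \<in> Q"
  shows "(\<lambda>y\<in>Q. a \<cdot> y) \<in> Bij Q"
proof -
  have "bij_betw (\<lambda>y. a \<cdot> y) Q Q"
    unfolding bij_betw_def inj_on_def image_def
    using right_solution[OF assms] closed[OF assms] by (auto; metis)
  then show ?thesis by (simp add: Bij_def)
qed

lemma (in quasigroup) right_translation_Bij:
  assumes "a \<in> Q"
  shows "(\<lambda>x\<in>Q. x \<cdot> a) \<in> Bij Q"
proof -
  have "bij_betw (\<lambda>x. x \<cdot> a) Q Q"
    unfolding bij_betw_def inj_on_def image_def
    using left_solution[OF assms] closed[OF _ assms] by (auto; metis)
  then show ?thesis by (simp add: Bij_def)
qed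

lemma (in quasigroup) abelian_group_isotope_if_transitive:
  assumes trans: "\<And>x y. x \<in> Q \<Longrightarrow> y \<in> Q \<Longrightarrow> \<exists>\<alpha> \<beta> \<gamma>. central_triple Q f \<alpha> \<beta> \<gamma> \<and> \<gamma> x = y"
  shows "abelian_group_isotope Q f"
proof -
  obtain u where u: "u \<in> Q" using nonempty by blast
  define C where "C = {\<gamma>. \<exists>\<alpha> \<beta>. central_triple Q f \<alpha> \<beta> \<gamma>}"
  obtain G :: "'a monoid" where G: "comm_group G" "carrier G = Q"
    and mult: "\<And>g b. g \<in> C \<Longrightarrow> b \<in> Q \<Longrightarrow> g (u \<cdot> u) \<otimes>\<^bsub>G\<^esub> b = g b"
  proof (rule comm_group_of_commuting_transitive[of "u \<cdot> u" Q C])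
    show "u \<cdot> u \<in> Q" using closed u by blast
    show "g x \<in> Q" if "g \<in> C" "x \<in> Q" for g x
      using that by (auto simp: C_def central_triple_def)
    show "g (h x) = h (g x)" if "g \<in> C" "h \<in> C" "x \<in> Q" for g h x
      using that central_triples_commute unfolding C_def by blast
    show "\<exists>g\<in>C. g x = y" if "x \<in> Q" "y \<in> Q" for x y
      using trans[OF that] unfolding C_def by blast
  qed (rule that)
  have eq: "x \<cdot> y = (x \<cdot> u) \<otimes>\<^bsub>G\<^esub> (u \<cdot> y)" if x: "x \<in> Q" and y: "y \<in> Q" for x y
  proof -
    obtain \<alpha> \<beta> \<gamma> where t: "central_triple Q f \<alpha> \<beta> \<gamma>" and \<gamma>: "\<gamma> (u \<cdot> u) = x \<cdot> u"
      using trans closed x u by meson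
    have "\<alpha> u \<in> Q" "\<alpha> u \<cdot> u = x \<cdot> u" using t \<gamma> u by (auto simp: central_triple_def)
    then have "\<alpha> u = x" using left_solution[OF u closed[OF x u]] x by blast
    then have "\<gamma> (u \<cdot> y) = x \<cdot> y" using t u y by (auto simp: central_triple_def)
    moreover have "\<gamma> \<in> C" using t unfolding C_def by blast
    ultimately show ?thesis using mult[of \<gamma> "u \<cdot> y"] \<gamma> closed[OF u y] by simp
  qed
  have "inv_into Q (\<lambda>x\<in>Q. x) z = z" if "z \<in> Q" for z
    using inv_into_f_f[of "\<lambda>x\<in>Q. x" Q z] that by (simp add: inj_on_def)
  then have "x \<cdot> y = inv_into Q (\<lambda>x\<in>Q. x) ((\<lambda>x\<in>Q. x \<cdot> u) x \<otimes>\<^bsub>G\<^esub> (\<lambda>y\<in>Q. u \<cdot> y) y)"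
    if "x \<in> Q" "y \<in> Q" for x y
    using eq[OF that] closed[OF that] that by simp
  then show ?thesis
    unfolding abelian_group_isotope_def
    using G left_translation_Bij[OF u] right_translation_Bij[OF u] id_Bij[of Q] by blast
qed

lemma acts_transitivelyD:
  "\<lbrakk>acts_transitively H Q; x \<in> Q; y \<in> Q\<rbrakk> \<Longrightarrow> \<exists>g\<in>H. g x = y"
  unfolding acts_transitively_def using transitive_action.unique_orbit by fastforce

lemma (in quasigroup) A_central_imp_abelian_group_isotope:
  assumes "A_central Q f"
  shows "abelian_group_isotope Q f"
proof (rule abelian_group_isotope_if_transitive, rule central_triples_transitive3)
  let ?T = "central_triple Q f"
  have comp1: "\<exists>\<beta> \<gamma>. ?T \<alpha> \<beta> \<gamma>"
    if "\<alpha> \<in> component1 (left_A_center Q f) \<union> component1 (middle_A_center Q f)" for \<alpha>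
    using that unfolding component1_def
    by (auto, (blast dest: left_A_center_central_triple middle_A_center_central_triple(1))+)
  have comp2: "\<exists>\<alpha> \<gamma>. ?T \<alpha> \<beta> \<gamma>"
    if "\<beta> \<in> component2 (right_A_center Q f) \<union> component2 (middle_A_center Q f)" for \<beta>
    using that unfolding component2_def
    by (auto, (blast dest: right_A_center_central_triple middle_A_center_central_triple(2))+)
  have comp3: "\<exists>\<alpha> \<beta>. ?T \<alpha> \<beta> \<gamma>"
    if "\<gamma> \<in> component3 (left_A_center Q f) \<union> component3 (right_A_center Q f)" for \<gamma>
    using that unfolding component3_def
    by (auto, (blast dest: left_A_center_central_triple right_A_center_central_triple)+)
  consider
    (1) H where "acts_transitively H Q" "\<forall>\<alpha>\<in>H. \<exists>\<beta> \<gamma>. ?T \<alpha> \<beta> \<gamma>"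
  | (2) H where "acts_transitively H Q" "\<forall>\<beta>\<in>H. \<exists>\<alpha> \<gamma>. ?T \<alpha> \<beta> \<gamma>"
  | (3) H where "acts_transitively H Q" "\<forall>\<gamma>\<in>H. \<exists>\<alpha> \<beta>. ?T \<alpha> \<beta> \<gamma>"
    using assms comp1 comp2 comp3 unfolding A_central_def by blast
  then show "(\<forall>x\<in>Q. \<forall>y\<in>Q. \<exists>\<alpha> \<beta> \<gamma>. ?T \<alpha> \<beta> \<gamma> \<and> \<alpha> x = y) \<or>
    (\<forall>x\<in>Q. \<forall>y\<in>Q. \<exists>\<alpha> \<beta> \<gamma>. ?T \<alpha> \<beta> \<gamma> \<and> \<beta> x = y) \<or>
    (\<forall>x\<in>Q. \<forall>y\<in>Q. \<exists>\<alpha> \<beta> \<gamma>. ?T \<alpha> \<beta> \<gamma> \<and> \<gamma> x = y)"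
  proof cases
    case (1 H)
    then have "\<forall>x\<in>Q. \<forall>y\<in>Q. \<exists>\<alpha> \<beta> \<gamma>. ?T \<alpha> \<beta> \<gamma> \<and> \<alpha> x = y" using acts_transitivelyD[of H Q] by meson
    then show ?thesis by blast
  next
    case (2 H)
    then have "\<forall>x\<in>Q. \<forall>y\<in>Q. \<exists>\<alpha> \<beta> \<gamma>. ?T \<alpha> \<beta> \<gamma> \<and> \<beta> x = y" using acts_transitivelyD[of H Q] by meson
    then show ?thesis by blast
  next
    case (3 H)
    then have "\<forall>x\<in>Q. \<forall>y\<in>Q. \<exists>\<alpha> \<beta> \<gamma>. ?T \<alpha> \<beta> \<gamma> \<and> \<gamma> x = y" using acts_transitivelyD[of H Q] by meson
    then show ?thesis by blast
  qed
qed

section \<open>Abelian group isotopes are A-central\<close>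

text \<open>The translation by \<open>a\<close> of a group \<open>G\<close>, conjugated by the bijection \<open>\<mu>\<close> of its carrier and
  restricted to the carrier.\<close>

definition conj_translation :: "('a, 'b) monoid_scheme \<Rightarrow> ('a \<Rightarrow> 'a) \<Rightarrow> 'a \<Rightarrow> 'a \<Rightarrow> 'a" where
  "conj_translation G \<mu> a = (\<lambda>x\<in>carrier G. inv_into (carrier G) \<mu> (\<mu> x \<otimes>\<^bsub>G\<^esub> a))"

lemma (in comm_group)
  assumes "\<mu> \<in> Bij (carrier G)" "x \<in> carrier G" "a \<in> carrier G"
  shows conj_translation_closed: "conj_translation G \<mu> a x \<in> carrier G"
    and apply_conj_translation: "\<mu> (conj_translation G \<mu> a x) = \<mu> x \<otimes> a"
proof -
  have "\<mu> x \<otimes> a \<in> carrier G" using assms Bij_imp_funcset[OF assms(1)] by auto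
  then show "conj_translation G \<mu> a x \<in> carrier G" "\<mu> (conj_translation G \<mu> a x) = \<mu> x \<otimes> a"
    using assms by (auto simp: conj_translation_def Bij_def bij_betw_def f_inv_into_f
        intro: inv_into_into)
qed

lemma (in comm_group) conj_translation_compose:
  assumes "\<mu> \<in> Bij (carrier G)" "x \<in> carrier G" "a \<in> carrier G" "b \<in> carrier G"
  shows "conj_translation G \<mu> a (conj_translation G \<mu> b x) = conj_translation G \<mu> (a \<otimes> b) x"
  using assms apply_conj_translation[OF assms(1,2,4)] conj_translation_closed[OF assms(1,2,4)]
    Bij_imp_funcset[OF assms(1)]
  by (simp add: conj_translation_def m_ac Pi_iff)

lemma (in comm_group) conj_translation_one:
  assumes "\<mu> \<in> Bij (carrier G)"
  shows "conj_translation G \<mu> \<one> = \<one>\<^bsub>BijGroup (carrier G)\<^esub>"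
  using assms Bij_imp_funcset[OF assms]
  by (auto simp: conj_translation_def BijGroup_def Bij_def bij_betw_def Pi_iff
      intro!: restrict_ext)

lemma (in comm_group) conj_translation_Bij:
  assumes "\<mu> \<in> Bij (carrier G)" "a \<in> carrier G"
  shows "conj_translation G \<mu> a \<in> Bij (carrier G)"
proof -
  have "conj_translation G \<mu> c (conj_translation G \<mu> d x) = x"
    if "c \<otimes> d = \<one>" "x \<in> carrier G" "c \<in> carrier G" "d \<in> carrier G" for c d x
    using that conj_translation_compose[OF assms(1)] conj_translation_one[OF assms(1)] by simp
  then have "bij_betw (conj_translation G \<mu> a) (carrier G) (carrier G)"
    using assms conj_translation_closed[OF assms(1)]
    by (intro bij_betw_byWitness[where f' = "conj_translation G \<mu> (inv a)"]) auto
  then show ?thesis by (simp add: Bij_def conj_translation_def)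
qed

lemma (in comm_group) group_hom_conj_translation:
  assumes "\<mu> \<in> Bij (carrier G)"
  shows "group_hom G (BijGroup (carrier G)) (conj_translation G \<mu>)"
proof -
  have "conj_translation G \<mu> (a \<otimes> b) =
      conj_translation G \<mu> a \<otimes>\<^bsub>BijGroup (carrier G)\<^esub> conj_translation G \<mu> b"
    if "a \<in> carrier G" "b \<in> carrier G" for a b
  proof (rule extensionalityI[where A = "carrier G"])
    show "conj_translation G \<mu> (a \<otimes> b) \<in> extensional (carrier G)"
      by (simp add: conj_translation_def)
    show "conj_translation G \<mu> a \<otimes>\<^bsub>BijGroup (carrier G)\<^esub> conj_translation G \<mu> b
        \<in> extensional (carrier G)"
      using conj_translation_Bij[OF assms] that by (simp add: BijGroup_def)
  qed (use conj_translation_Bij conj_translation_compose assms that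
      in \<open>simp add: mult_BijGroup_apply\<close>)
  then show ?thesis
    using conj_translation_Bij[OF assms]
    by (intro group_hom.intro group_hom_axioms.intro is_group group_BijGroup)
      (auto simp: hom_def carrier_BijGroup)
qed

lemma acts_transitivelyI:
  assumes "subgroup H (BijGroup Q)" "\<And>x y. x \<in> Q \<Longrightarrow> y \<in> Q \<Longrightarrow> \<exists>g\<in>H. g x = y"
  shows "acts_transitively H Q"
proof -
  have "id \<in> hom ((BijGroup Q)\<lparr>carrier := H\<rparr>) (BijGroup Q)"
    using subgroup.subset[OF assms(1)] by (auto simp: hom_def)
  then show ?thesis
    using assms(2) subgroup.subgroup_is_group[OF assms(1) group_BijGroup] group_BijGroup[of Q]
    unfolding acts_transitively_def
    by (intro transitive_action.intro group_action.intro transitive_action_axioms.intro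
        group_hom.intro group_hom_axioms.intro) auto
qed

lemma (in comm_group) conj_translations_act_transitively:
  assumes "\<mu> \<in> Bij (carrier G)"
  shows "acts_transitively (conj_translation G \<mu> ` carrier G) (carrier G)"
proof (rule acts_transitivelyI)
  show "subgroup (conj_translation G \<mu> ` carrier G) (BijGroup (carrier G))"
    using group_hom.img_is_subgroup[OF group_hom_conj_translation[OF assms]] .
next
  fix x y assume xy: "x \<in> carrier G" "y \<in> carrier G"
  have \<mu>: "\<mu> x \<in> carrier G" "\<mu> y \<in> carrier G" using assms xy Bij_imp_funcset by blast+
  let ?a = "inv (\<mu> x) \<otimes> \<mu> y"
  have "conj_translation G \<mu> ?a x = inv_into (carrier G) \<mu> (\<mu> y)"
    using xy \<mu> by (simp add: conj_translation_def m_assoc[symmetric])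
  also have "\<dots> = y" using assms xy by (simp add: Bij_def bij_betw_def)
  finally show "\<exists>g\<in>conj_translation G \<mu> ` carrier G. g x = y" using \<mu> by blast
qed

text \<open>A binary operation \<open>f\<close> on the carrier of an abelian group \<open>G\<close> that is isotopic to \<open>G\<close>, with
  \<open>\<mu>\<^sub>3\<^sup>-\<^sup>1\<close> applied to the sum of \<open>\<mu>\<^sub>1 x\<close> and \<open>\<mu>\<^sub>2 y\<close>.\<close>

locale isotope_of_comm_group = comm_group G for G :: "'a monoid" (structure) +
  fixes f :: "'a \<Rightarrow> 'a \<Rightarrow> 'a" and \<mu>\<^sub>1 \<mu>\<^sub>2 \<mu>\<^sub>3 :: "'a \<Rightarrow> 'a"
  assumes Bij: "\<mu>\<^sub>1 \<in> Bij (carrier G)" "\<mu>\<^sub>2 \<in> Bij (carrier G)" "\<mu>\<^sub>3 \<in> Bij (carrier G)"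
    and isotopy: "\<And>x y. \<lbrakk>x \<in> carrier G; y \<in> carrier G\<rbrakk> \<Longrightarrow>
      f x y = inv_into (carrier G) \<mu>\<^sub>3 (\<mu>\<^sub>1 x \<otimes> \<mu>\<^sub>2 y)"
begin

lemma \<mu>_closed:
  assumes "x \<in> carrier G"
  shows "\<mu>\<^sub>1 x \<in> carrier G" "\<mu>\<^sub>2 x \<in> carrier G" "\<mu>\<^sub>3 x \<in> carrier G"
  using Bij assms Bij_imp_funcset by blast+

lemma
  assumes "x \<in> carrier G" "y \<in> carrier G"
  shows f_closed: "f x y \<in> carrier G"
    and \<mu>\<^sub>3_f: "\<mu>\<^sub>3 (f x y) = \<mu>\<^sub>1 x \<otimes> \<mu>\<^sub>2 y"
proof -
  have "\<mu>\<^sub>1 x \<otimes> \<mu>\<^sub>2 y \<in> carrier G" using assms \<mu>_closed by blast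
  then show "f x y \<in> carrier G" "\<mu>\<^sub>3 (f x y) = \<mu>\<^sub>1 x \<otimes> \<mu>\<^sub>2 y"
    using Bij(3) assms
    by (auto simp: isotopy Bij_def bij_betw_def f_inv_into_f intro: inv_into_into)
qed

lemma conj_translations_autotopy:
  assumes a: "a \<in> carrier G" and b: "b \<in> carrier G"
  shows "(conj_translation G \<mu>\<^sub>1 a, conj_translation G \<mu>\<^sub>2 b, conj_translation G \<mu>\<^sub>3 (a \<otimes> b))
    \<in> autotopies (carrier G) f"
proof -
  have "f (conj_translation G \<mu>\<^sub>1 a x) (conj_translation G \<mu>\<^sub>2 b y) =
      conj_translation G \<mu>\<^sub>3 (a \<otimes> b) (f x y)" if x: "x \<in> carrier G" and y: "y \<in> carrier G" for x y
  proof -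
    have "f (conj_translation G \<mu>\<^sub>1 a x) (conj_translation G \<mu>\<^sub>2 b y) =
        inv_into (carrier G) \<mu>\<^sub>3 ((\<mu>\<^sub>1 x \<otimes> a) \<otimes> (\<mu>\<^sub>2 y \<otimes> b))"
      using Bij a b x y by (simp add: isotopy conj_translation_closed apply_conj_translation)
    also have "(\<mu>\<^sub>1 x \<otimes> a) \<otimes> (\<mu>\<^sub>2 y \<otimes> b) = \<mu>\<^sub>3 (f x y) \<otimes> (a \<otimes> b)"
      using a b x y \<mu>_closed by (simp add: \<mu>\<^sub>3_f m_ac)
    finally show ?thesis using x y by (simp add: conj_translation_def f_closed)
  qed
  then show ?thesis using a b Bij by (simp add: autotopies_def conj_translation_Bij)
qed

text \<open>If \<open>(\<alpha>, \<epsilon>, \<gamma>)\<close> is an autotopy, then \<open>\<mu>\<^sub>1 (\<alpha> x) + \<mu>\<^sub>2 y\<close> depends only on \<open>\<mu>\<^sub>1 x + \<mu>\<^sub>2 y\<close>; hence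
  \<open>\<mu>\<^sub>1 (\<alpha> x) - \<mu>\<^sub>1 x\<close> is constant.\<close>

lemma left_A_nucleus_component1:
  assumes "(\<alpha>, \<beta>, \<gamma>) \<in> left_A_nucleus (carrier G) f"
  shows "\<alpha> \<in> conj_translation G \<mu>\<^sub>1 ` carrier G"
proof -
  have \<alpha>: "\<alpha> \<in> Bij (carrier G)"
    and aut: "\<And>x y. \<lbrakk>x \<in> carrier G; y \<in> carrier G\<rbrakk> \<Longrightarrow> f (\<alpha> x) y = \<gamma> (f x y)"
    using assms by (auto simp: left_A_nucleus_def carrier_Avt autotopies_def)
  have \<alpha>_closed: "\<alpha> x \<in> carrier G" if "x \<in> carrier G" for x
    using \<alpha> that Bij_imp_funcset by blast
  have surj: "\<exists>x\<in>carrier G. \<mu> x = c" if "\<mu> \<in> Bij (carrier G)" "c \<in> carrier G" for \<mu> c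
    using that by (metis Bij_def IntE bij_betw_imp_surj_on imageE mem_Collect_eq)
  obtain z where z: "z \<in> carrier G" "\<mu>\<^sub>1 z = \<one>" using surj Bij(1) by blast
  obtain w where w: "w \<in> carrier G" "\<mu>\<^sub>2 w = \<one>" using surj Bij(2) by blast
  have "\<alpha> x = conj_translation G \<mu>\<^sub>1 (\<mu>\<^sub>1 (\<alpha> z)) x" if x: "x \<in> carrier G" for x
  proof -
    \<comment> \<open>As \<open>\<mu>\<^sub>1 x \<otimes> \<one> = \<one> \<otimes> \<mu>\<^sub>1 x\<close>, the product of \<open>x\<close> and \<open>w\<close> is also that of \<open>z\<close> and this \<open>y\<close>.\<close>
    obtain y where y: "y \<in> carrier G" "\<mu>\<^sub>2 y = \<mu>\<^sub>1 x" using surj Bij(2) \<mu>_closed x by metis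
    have "f x w = f z y" using x y z w \<mu>_closed by (simp add: isotopy)
    then have "f (\<alpha> x) w = f (\<alpha> z) y" using aut x y z w by metis
    then have "\<mu>\<^sub>1 (\<alpha> x) \<otimes> \<mu>\<^sub>2 w = \<mu>\<^sub>1 (\<alpha> z) \<otimes> \<mu>\<^sub>2 y" using \<mu>\<^sub>3_f \<alpha>_closed x y z w by metis
    then have "\<mu>\<^sub>1 (\<alpha> x) = \<mu>\<^sub>1 x \<otimes> \<mu>\<^sub>1 (\<alpha> z)"
      using x y z w \<mu>_closed \<alpha>_closed by (simp add: m_comm)
    then have "conj_translation G \<mu>\<^sub>1 (\<mu>\<^sub>1 (\<alpha> z)) x = inv_into (carrier G) \<mu>\<^sub>1 (\<mu>\<^sub>1 (\<alpha> x))"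
      using x by (simp add: conj_translation_def)
    also have "\<dots> = \<alpha> x" using Bij(1) \<alpha>_closed[OF x] by (simp add: Bij_def bij_betw_def)
    finally show ?thesis by simp
  qed
  then have "\<alpha> = conj_translation G \<mu>\<^sub>1 (\<mu>\<^sub>1 (\<alpha> z))"
    using \<alpha> by (intro extensionalityI[of _ "carrier G"])
      (auto simp: Bij_imp_extensional conj_translation_def)
  then show ?thesis using \<mu>_closed \<alpha>_closed z by blast
qed

lemma conj_translation_left_A_center:
  assumes a: "a \<in> carrier G"
  shows "(conj_translation G \<mu>\<^sub>1 a, \<one>\<^bsub>BijGroup (carrier G)\<^esub>, conj_translation G \<mu>\<^sub>3 a)
    \<in> left_A_center (carrier G) f"
proof -
  let ?Q = "carrier G" and ?\<epsilon> = "\<one>\<^bsub>BijGroup (carrier G)\<^esub>"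
  let ?\<alpha> = "conj_translation G \<mu>\<^sub>1 a" and ?\<beta> = "conj_translation G \<mu>\<^sub>2"
    and ?\<gamma> = "conj_translation G \<mu>\<^sub>3 a"
  have l: "(?\<alpha>, ?\<epsilon>, ?\<gamma>) \<in> left_A_nucleus ?Q f"
    using conj_translations_autotopy[OF a one_closed] a Bij
    by (simp add: left_A_nucleus_def carrier_Avt conj_translation_one)
  have r: "(?\<epsilon>, ?\<beta> a, ?\<gamma>) \<in> right_A_nucleus ?Q f"
    using conj_translations_autotopy[OF one_closed a] a Bij
    by (simp add: right_A_nucleus_def carrier_Avt conj_translation_one)
  have m: "(?\<alpha>, ?\<beta> (inv a), ?\<epsilon>) \<in> middle_A_nucleus ?Q f"
    using conj_translations_autotopy[OF a inv_closed[OF a]] a Bij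
    by (simp add: middle_A_nucleus_def carrier_Avt conj_translation_one)
  have "?\<beta> a \<otimes>\<^bsub>BijGroup ?Q\<^esub> ?\<beta> (inv a) = ?\<epsilon>"
    using group_hom.hom_mult[OF group_hom_conj_translation[OF Bij(2)], of a "inv a"] a Bij
    by (simp add: conj_translation_one)
  then have "(?\<alpha>, ?\<epsilon>, ?\<gamma>) = (?\<epsilon>, ?\<beta> a, ?\<gamma>) \<otimes>\<^bsub>Avt ?Q f\<^esub> (?\<alpha>, ?\<beta> (inv a), ?\<epsilon>)"
    using a Bij by (simp add: mult_Avt mult_BijGroup_one conj_translation_Bij)
  then show ?thesis using l r m unfolding left_A_center_def set_mult_def by blast
qed

lemma component1_left_A_center:
  "component1 (left_A_center (carrier G) f) = conj_translation G \<mu>\<^sub>1 ` carrier G"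
proof
  show "component1 (left_A_center (carrier G) f) \<subseteq> conj_translation G \<mu>\<^sub>1 ` carrier G"
    using left_A_nucleus_component1 by (auto simp: component1_def left_A_center_def)
  show "conj_translation G \<mu>\<^sub>1 ` carrier G \<subseteq> component1 (left_A_center (carrier G) f)"
    using conj_translation_left_A_center by (force simp: component1_def)
qed

lemma A_central: "A_central (carrier G) f"
  unfolding A_central_def component1_left_A_center
  using conj_translations_act_transitively[OF Bij(1)] by blast

end

theorem theorem3p24:
  fixes Q :: "'a set" and f :: "'a \<Rightarrow> 'a \<Rightarrow> 'a"
  assumes "quasigroup Q f"
  shows "A_central Q f \<longleftrightarrow> abelian_group_isotope Q f"
proof
  show "abelian_group_isotope Q f" if "A_central Q f"
    using assms that by (rule quasigroup.A_central_imp_abelian_group_isotope)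
next
  assume "abelian_group_isotope Q f"
  then obtain G :: "'a monoid" and \<mu>\<^sub>1 \<mu>\<^sub>2 \<mu>\<^sub>3 where G: "comm_group G" "carrier G = Q"
    and "\<mu>\<^sub>1 \<in> Bij Q" "\<mu>\<^sub>2 \<in> Bij Q" "\<mu>\<^sub>3 \<in> Bij Q"
    "\<forall>x\<in>Q. \<forall>y\<in>Q. f x y = inv_into Q \<mu>\<^sub>3 (\<mu>\<^sub>1 x \<otimes>\<^bsub>G\<^esub> \<mu>\<^sub>2 y)"
    unfolding abelian_group_isotope_def by blast
  then have "isotope_of_comm_group G f \<mu>\<^sub>1 \<mu>\<^sub>2 \<mu>\<^sub>3"
    by (simp add: isotope_of_comm_group_def isotope_of_comm_group_axioms_def)
  then show "A_central Q f" using isotope_of_comm_group.A_central G(2) by blast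
qed

end
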